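(* Let $a\leq b$ be positive integers, where $a$ is odd and $b\equiv 2\pmod 4$, and let $n=ab$. Then $\mathrm{MiD}(L_{a,b})\geq \dfrac{n-\min\{4a,b\}}{2}$.
   Context: A Latin square of order $n$ is an $n\times n$ array with entries from $\{1,2,\dots,n\}$ such that each row and each column contains every symbol exactly once. For positive integers $a,b$ and $n=ab$, an $(a,b)$-Sudoku Latin square is a Latin square of order $n$ such that, when the array is tiled by $a\times b$ blocks ($a$ consecutive rows $ka+1,\dots,(k+1)a$ by $b$ consecutive columns $lb+1,\dots,(l+1)b$), each block contains every symbol of $\{1,\dots,n\}$ exactly once. Two cells are adjacent if they share an edge horizontally or vertically (no wrap-around). The distance between two adjacent cells containing symbols $u,v$ is $\min\{(u-v)\bmod n,\ (v-u)\bmod n\}$, residues being taken in $\{0,\dots,n-1\}$. The inner distance of a Latin square of order $n\ge2$ is the minimum of the distances over all pairs of adjacent cells. $\mathrm{MiD}(L_{a,b})$ denotes the maximum of the inner distances of all $(a,b)$-Sudoku Latin squares. *)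

theory Defs
  imports Complex_Main
begin

text \<open>
  An array of order \<open>n\<close> is a function \<open>L\<close>, where \<open>L i j\<close> is the symbol in row \<open>i\<close> and column \<open>j\<close>.
  Rows, columns and symbols are numbered \<open>1, \<dots>, n\<close>; the values of \<open>L\<close> at other indices are
  unconstrained and do not enter any of the notions below.
\<close>

definition latin_square :: "nat \<Rightarrow> (nat \<Rightarrow> nat \<Rightarrow> nat) \<Rightarrow> bool" where
  "latin_square n L \<longleftrightarrow>
     (\<forall>i\<in>{1..n}. bij_betw (\<lambda>j. L i j) {1..n} {1..n}) \<and>
     (\<forall>j\<in>{1..n}. bij_betw (\<lambda>i. L i j) {1..n} {1..n})"

text \<open>The \<open>a \<times> b\<close> blocks tiling the array form \<open>b\<close> bands of rows and \<open>a\<close> bands of columns.\<close>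

definition sudoku_latin_square :: "nat \<Rightarrow> nat \<Rightarrow> (nat \<Rightarrow> nat \<Rightarrow> nat) \<Rightarrow> bool" where
  "sudoku_latin_square a b L \<longleftrightarrow>
     latin_square (a * b) L \<and>
     (\<forall>k<b. \<forall>l<a. bij_betw (\<lambda>(i, j). L i j)
        ({k * a + 1..(k + 1) * a} \<times> {l * b + 1..(l + 1) * b}) {1..a * b})"

definition adjacent :: "nat \<times> nat \<Rightarrow> nat \<times> nat \<Rightarrow> bool" where
  "adjacent p q \<longleftrightarrow>
     (fst p = fst q \<and> (snd q = snd p + 1 \<or> snd p = snd q + 1)) \<or>
     (snd p = snd q \<and> (fst q = fst p + 1 \<or> fst p = fst q + 1))"

text \<open>The differences are taken in \<open>int\<close>, where \<open>x mod int n\<close> lies in \<open>{0..<int n}\<close> for \<open>n > 0\<close>.\<close>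

definition symbol_dist :: "nat \<Rightarrow> nat \<Rightarrow> nat \<Rightarrow> int" where
  "symbol_dist n u v = min ((int u - int v) mod int n) ((int v - int u) mod int n)"

text \<open>Meaningful for \<open>n \<ge> 2\<close> only; for smaller \<open>n\<close> there are no adjacent cells.\<close>

definition inner_distance :: "nat \<Rightarrow> (nat \<Rightarrow> nat \<Rightarrow> nat) \<Rightarrow> int" where
  "inner_distance n L =
     Min {symbol_dist n (L (fst p) (snd p)) (L (fst q) (snd q)) | p q.
            p \<in> {1..n} \<times> {1..n} \<and> q \<in> {1..n} \<times> {1..n} \<and> adjacent p q}"

definition MiD :: "nat \<Rightarrow> nat \<Rightarrow> int" where
  "MiD a b = Max {inner_distance (a * b) L | L. sudoku_latin_square a b L}"

end

theory Submission
  imports Defs "HOL-Number_Theory.Cong"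
begin

text \<open>
  Put \<open>n = 2 h\<close>; since \<open>a\<close> is odd and \<open>b \<equiv> 2 (mod 4)\<close>, \<open>h\<close> is odd. The witness is a square with
  entries \<open>r\<^sub>i + c\<^sub>j\<close> modulo \<open>n\<close>, where \<open>r\<close> and \<open>c\<close> both run through all residues. Adjacent entries of
  such a square differ by a step of \<open>r\<close> or of \<open>c\<close>, so it suffices that all these steps are \<open>h + d\<close>
  modulo \<open>n\<close> with \<open>\<bar>d\<bar> \<le> w = min {4a, b} / 2\<close>.

  The blocks are correct if every band of \<open>r\<close> plus every band of \<open>c\<close> covers all residues without
  repetition. This is arranged by letting the bands of one line be the cosets of a subgroup
  \<open>q \<int> / n\<close> (\<open>n = p q\<close>), whereas each band of the other line represents every class modulo \<open>q\<close> once
  (\<open>block_separation\<close>). For the second line the multiples of \<open>h + 2\<close> work: as \<open>h\<close> is odd,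
  \<open>h + 2\<close> is coprime to \<open>n\<close>, so consecutive multiples are distinct both modulo \<open>n\<close> and, in runs of
  length \<open>q\<close>, modulo \<open>q\<close>. For the first line one walks through a coset with steps \<open>h + w\<close>, where \<open>h + w\<close>
  generates \<open>q \<int> / n\<close>, and then passes to the next coset with a step \<open>h + 1 - w\<close>.

  It remains to choose the generator. If \<open>4a < b\<close>, the columns follow cosets of the multiples of \<open>a\<close>:
  the subgroup has even order \<open>b\<close> and contains \<open>h = a \<cdot> b/2\<close>, which only has order 2; the
  factor \<open>b/2 + 2\<close> is coprime to \<open>b\<close> and gives the generator \<open>h + 2a\<close>, so \<open>w = 2a\<close>. Otherwise the rows
  follow cosets of the multiples of \<open>b\<close>: the subgroup has odd order \<open>a\<close>, and \<open>h + b/2 = b (a + 1)/2\<close>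
  generates it, so \<open>w = b/2\<close>.
\<close>

section \<open>Sudoku squares as sums of two sequences modulo n\<close>

text \<open>
  The sequences are indexed from 0, so that the bands of \<open>a\<close> rows are the classes of indices with
  equal quotient by \<open>a\<close>; the shift by 1 restores the numbering of rows, columns and symbols.
\<close>

definition cyclic_square :: "nat \<Rightarrow> (nat \<Rightarrow> int) \<Rightarrow> (nat \<Rightarrow> int) \<Rightarrow> nat \<Rightarrow> nat \<Rightarrow> nat" where
  "cyclic_square n r c i j = nat ((r (i - 1) + c (j - 1)) mod int n) + 1"

definition inj_mod :: "nat \<Rightarrow> (nat \<Rightarrow> int) \<Rightarrow> bool" where
  "inj_mod n x \<longleftrightarrow> (\<forall>s<n. \<forall>t<n. [x s = x t] (mod int n) \<longrightarrow> s = t)"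

lemma cyclic_square_eq_iff:
  assumes "0 < n"
  shows "cyclic_square n r c i j = cyclic_square n r c i' j' \<longleftrightarrow>
    [r (i - 1) + c (j - 1) = r (i' - 1) + c (j' - 1)] (mod int n)"
  using assms by (simp add: cyclic_square_def cong_def eq_nat_nat_iff)

lemma cyclic_square_in_range:
  assumes "0 < n"
  shows "cyclic_square n r c i j \<in> {1..n}"
proof -
  have "(r (i - 1) + c (j - 1)) mod int n < int n" using assms by simp
  then show ?thesis using assms by (simp add: cyclic_square_def nat_less_iff Suc_le_eq)
qed

lemma bij_betw_if_inj_on_card:
  assumes "inj_on f A" "f ` A \<subseteq> B" "finite B" "card A = card B"
  shows "bij_betw f A B"
  using assms by (simp add: bij_betw_def card_image card_subset_eq)

lemma div_pred_eq_if_in_band: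
  fixes i k m :: nat
  assumes "i \<in> {k * m + 1..(k + 1) * m}"
  shows "(i - 1) div m = k"
  using assms by (intro div_nat_eqI) (auto simp: algebra_simps)

text \<open>
  All sets in question have as many cells as there are symbols, so injectivity is enough everywhere;
  in a row or a column the constant summand cancels.
\<close>

lemma sudoku_cyclic_square:
  assumes pos: "0 < a" "0 < b"
    and r: "inj_mod (a * b) r" and c: "inj_mod (a * b) c"
    and block: "\<And>i i' j j'. i div a = i' div a \<Longrightarrow> j div b = j' div b \<Longrightarrow>
      [r i + c j = r i' + c j'] (mod int (a * b)) \<Longrightarrow> i = i' \<and> j = j'"
  shows "sudoku_latin_square a b (cyclic_square (a * b) r c)"
proof -
  let ?n = "a * b" and ?L = "cyclic_square (a * b) r c"
  have n: "0 < ?n" using pos by simp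
  note eq = cyclic_square_eq_iff[OF n] and range = cyclic_square_in_range[OF n]
  have rows: "bij_betw (\<lambda>j. ?L i j) {1..?n} {1..?n}" for i
  proof (rule bij_betw_if_inj_on_card)
    show "inj_on (\<lambda>j. ?L i j) {1..?n}"
    proof (rule inj_onI)
      fix j j' assume j: "j \<in> {1..?n}" "j' \<in> {1..?n}" and "?L i j = ?L i j'"
      then have "[c (j - 1) = c (j' - 1)] (mod int ?n)" by (simp only: eq cong_add_lcancel)
      moreover have "j - 1 < ?n" "j' - 1 < ?n" using j n by auto
      ultimately have "j - 1 = j' - 1" using c unfolding inj_mod_def by blast
      then show "j = j'" using j by auto
    qed
  qed (use range in auto)
  have columns: "bij_betw (\<lambda>i. ?L i j) {1..?n} {1..?n}" for j
  proof (rule bij_betw_if_inj_on_card)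
    show "inj_on (\<lambda>i. ?L i j) {1..?n}"
    proof (rule inj_onI)
      fix i i' assume i: "i \<in> {1..?n}" "i' \<in> {1..?n}" and "?L i j = ?L i' j"
      then have "[r (i - 1) = r (i' - 1)] (mod int ?n)" by (simp only: eq cong_add_rcancel)
      moreover have "i - 1 < ?n" "i' - 1 < ?n" using i n by auto
      ultimately have "i - 1 = i' - 1" using r unfolding inj_mod_def by blast
      then show "i = i'" using i by auto
    qed
  qed (use range in auto)
  have blocks: "bij_betw (\<lambda>(i, j). ?L i j)
      ({k * a + 1..(k + 1) * a} \<times> {l * b + 1..(l + 1) * b}) {1..?n}" for k l
  proof (rule bij_betw_if_inj_on_card)
    show "inj_on (\<lambda>(i, j). ?L i j) ({k * a + 1..(k + 1) * a} \<times> {l * b + 1..(l + 1) * b})"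
    proof (rule inj_onI, clarify)
      fix i j i' j'
      assume i: "i \<in> {k * a + 1..(k + 1) * a}" "i' \<in> {k * a + 1..(k + 1) * a}"
        and j: "j \<in> {l * b + 1..(l + 1) * b}" "j' \<in> {l * b + 1..(l + 1) * b}"
        and L: "?L i j = ?L i' j'"
      have "i - 1 = i' - 1 \<and> j - 1 = j' - 1"
        using L i j by (intro block) (simp_all only: eq div_pred_eq_if_in_band)
      then show "i = i' \<and> j = j'" using i j by auto
    qed
  qed (use range in auto)
  show ?thesis
    unfolding sudoku_latin_square_def latin_square_def using rows columns blocks by blast
qed

section \<open>Inner distances\<close>

text \<open>
  Antipodal residues modulo \<open>2 h\<close> are those that differ by \<open>h\<close>, the largest possible distance.
\<close>

definition near_antipodal :: "int \<Rightarrow> int \<Rightarrow> int \<Rightarrow> int \<Rightarrow> bool" where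
  "near_antipodal h w u v \<longleftrightarrow> (\<exists>d. \<bar>d\<bar> \<le> w \<and> [u - v = h + d] (mod 2 * h))"

text \<open>Negation turns \<open>h + d\<close> into \<open>h - d\<close>, because \<open>- h\<close> and \<open>h\<close> agree modulo \<open>2 h\<close>.\<close>

lemma near_antipodal_sym:
  assumes "near_antipodal h w u v"
  shows "near_antipodal h w v u"
proof -
  from assms obtain d where d: "\<bar>d\<bar> \<le> w" "[u - v = h + d] (mod 2 * h)"
    unfolding near_antipodal_def by blast
  from d(2) have "2 * h dvd (h + d) - (u - v)" by (simp add: cong_iff_dvd_diff dvd_diff_commute)
  then have "2 * h dvd (h + d) - (u - v) - 2 * h" by (rule dvd_diff) simp
  then have "[v - u = h + (- d)] (mod 2 * h)" by (simp add: cong_iff_dvd_diff algebra_simps)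
  with d(1) show ?thesis unfolding near_antipodal_def by (metis abs_minus_cancel)
qed

lemma symbol_dist_nonneg:
  assumes "0 < n"
  shows "0 \<le> symbol_dist n u v"
  using assms by (simp add: symbol_dist_def)

lemma symbol_dist_less:
  assumes "0 < n"
  shows "symbol_dist n u v < int n"
  using assms by (simp add: symbol_dist_def min_less_iff_disj)

lemma mod_near_antipodal:
  assumes "near_antipodal h w u v" "w < h"
  shows "h - w \<le> (u - v) mod (2 * h)"
proof -
  from assms obtain d where d: "\<bar>d\<bar> \<le> w" "[u - v = h + d] (mod 2 * h)"
    unfolding near_antipodal_def by blast
  have "(u - v) mod (2 * h) = (h + d) mod (2 * h)" using d(2) by (simp add: cong_def)
  also have "\<dots> = h + d" using d(1) assms(2) by (intro mod_pos_pos_trivial) auto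
  finally show ?thesis using d(1) by simp
qed

lemma symbol_dist_near_antipodal:
  assumes "near_antipodal h w (int u) (int v)" "int n = 2 * h" "0 < n"
  shows "h - w \<le> symbol_dist n u v"
proof (cases "w < h")
  case True
  then show ?thesis
    using mod_near_antipodal[OF assms(1)] mod_near_antipodal[OF near_antipodal_sym[OF assms(1)]]
      assms(2) by (simp add: symbol_dist_def)
next
  case False
  then show ?thesis using symbol_dist_nonneg[OF assms(3), of u v] by linarith
qed

abbreviation adjacent_dists :: "nat \<Rightarrow> (nat \<Rightarrow> nat \<Rightarrow> nat) \<Rightarrow> int set" where
  "adjacent_dists n L \<equiv> {symbol_dist n (L (fst p) (snd p)) (L (fst q) (snd q)) | p q.
     p \<in> {1..n} \<times> {1..n} \<and> q \<in> {1..n} \<times> {1..n} \<and> adjacent p q}"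

lemma finite_adjacent_dists: "finite (adjacent_dists n L)"
proof (rule finite_subset)
  show "adjacent_dists n L \<subseteq> (\<lambda>(p, q). symbol_dist n (L (fst p) (snd p)) (L (fst q) (snd q))) `
      (({1..n} \<times> {1..n}) \<times> ({1..n} \<times> {1..n}))"
    by force
qed simp

lemma adjacent_dists_nonempty:
  assumes "2 \<le> n"
  shows "adjacent_dists n L \<noteq> {}"
proof -
  have "adjacent (1, 1) (1, 2)" by (simp add: adjacent_def)
  moreover have "(1, 1) \<in> {1..n} \<times> {1..n}" "(1, 2) \<in> {1..n} \<times> {1..n}" using assms by auto
  ultimately show ?thesis by blast
qed

lemma inner_distance_ge_iff:
  assumes "2 \<le> n"
  shows "m \<le> inner_distance n L \<longleftrightarrow> (\<forall>x\<in>adjacent_dists n L. m \<le> x)"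
  unfolding inner_distance_def
  by (rule Min_ge_iff[OF finite_adjacent_dists adjacent_dists_nonempty[OF assms]])

text \<open>
  There are infinitely many squares, because values outside the array are arbitrary, but their inner
  distances lie in a finite range, so the maximum in the definition of \<open>MiD\<close> is meaningful.
\<close>

lemma inner_distance_le_MiD:
  assumes "2 \<le> a * b" "sudoku_latin_square a b L"
  shows "inner_distance (a * b) L \<le> MiD a b"
proof -
  have "inner_distance (a * b) M \<in> {0..int (a * b)}" for M
  proof -
    have "inner_distance (a * b) M \<in> adjacent_dists (a * b) M"
      unfolding inner_distance_def
      by (rule Min_in[OF finite_adjacent_dists adjacent_dists_nonempty[OF assms(1)]])
    then obtain u v where "inner_distance (a * b) M = symbol_dist (a * b) u v" by blast
    moreover have "0 < a * b" using assms(1) by linarith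
    ultimately show ?thesis
      using symbol_dist_nonneg[of "a * b" u v] symbol_dist_less[of "a * b" u v] by simp
  qed
  then have "finite {inner_distance (a * b) M | M. sudoku_latin_square a b M}"
    by (intro finite_subset[OF _ finite_atLeastAtMost_int[of 0 "int (a * b)"]]) blast
  then show ?thesis unfolding MiD_def using assms(2) by (intro Max_ge) auto
qed

lemma near_antipodal_cyclic_square:
  assumes "int n = 2 * h" "0 < n"
    and "near_antipodal h w (r (i' - 1) + c (j' - 1)) (r (i - 1) + c (j - 1))"
  shows "near_antipodal h w (int (cyclic_square n r c i' j')) (int (cyclic_square n r c i j))"
proof -
  have "[int (cyclic_square n r c i' j') - int (cyclic_square n r c i j) =
      (r (i' - 1) + c (j' - 1)) - (r (i - 1) + c (j - 1))] (mod 2 * h)"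
    using assms(1,2) by (simp add: cyclic_square_def cong_def mod_diff_eq)
  then show ?thesis using assms(3) unfolding near_antipodal_def by (meson cong_trans)
qed

lemma inner_distance_cyclic_square:
  assumes n: "int n = 2 * h" "2 \<le> n"
    and r: "\<And>t. near_antipodal h w (r (Suc t)) (r t)"
    and c: "\<And>t. near_antipodal h w (c (Suc t)) (c t)"
  shows "h - w \<le> inner_distance n (cyclic_square n r c)"
proof -
  let ?L = "cyclic_square n r c"
  have n0: "0 < n" using n(2) by simp
  have right: "near_antipodal h w (int (?L i (j + 1))) (int (?L i j))" if "1 \<le> j" for i j
    using c[of "j - 1"] that
    by (intro near_antipodal_cyclic_square[OF n(1) n0]) (simp add: near_antipodal_def)
  have down: "near_antipodal h w (int (?L (i + 1) j)) (int (?L i j))" if "1 \<le> i" for i j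
    using r[of "i - 1"] that
    by (intro near_antipodal_cyclic_square[OF n(1) n0]) (simp add: near_antipodal_def)
  have "h - w \<le> symbol_dist n (?L i j) (?L i' j')"
    if "1 \<le> i" "1 \<le> j" "1 \<le> i'" "1 \<le> j'" "adjacent (i, j) (i', j')" for i j i' j'
  proof (rule symbol_dist_near_antipodal[OF _ n(1) n0])
    show "near_antipodal h w (int (?L i j)) (int (?L i' j'))"
      using that(5) right[OF that(2)] right[OF that(4)] down[OF that(1)] down[OF that(3)]
        near_antipodal_sym
      unfolding adjacent_def fst_conv snd_conv by metis
  qed
  then show ?thesis unfolding inner_distance_ge_iff[OF n(2)] by auto
qed

section \<open>A coset walk and a complementary arithmetic progression\<close>

text \<open>
  The walk visits cosets of \<open>p\<close> elements one after the other, with steps \<open>h + w\<close> inside a coset. If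
  \<open>p (h + w)\<close> vanishes modulo \<open>n\<close>, the last element of a coset is its first one minus \<open>h + w\<close>. The
  first elements differ by \<open>1 - 2w\<close> so that the step between cosets becomes
  \<open>(1 - 2w) + (h + w) = h + 1 - w\<close>.
\<close>

definition coset_line :: "nat \<Rightarrow> int \<Rightarrow> int \<Rightarrow> nat \<Rightarrow> int" where
  "coset_line p h w t = int (t div p) * (1 - 2 * w) + int (t mod p) * (h + w)"

definition step_line :: "int \<Rightarrow> nat \<Rightarrow> int" where
  "step_line h t = int t * (h + 2)"

lemma nat_eq_if_div_eq_cong:
  fixes s t m :: nat
  assumes "s div m = t div m" "[int s = int t] (mod int m)"
  shows "s = t"
proof -
  have "[s = t] (mod m)" using assms(2) by (simp only: cong_int_iff)
  then have "s mod m = t mod m" by (simp only: cong_def)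
  then show ?thesis using assms(1) by (metis div_mult_mod_eq)
qed

text \<open>
  The last two assumptions say that \<open>h + w\<close> generates the subgroup of order \<open>p\<close>, the multiples of \<open>q\<close>,
  in the integers modulo \<open>p q\<close>.
\<close>

locale line_pair =
  fixes p q :: nat and h w g :: int
  assumes order: "int p * int q = 2 * h" and odd_h: "odd h"
    and coset_step: "h + w = int q * g" and generator: "coprime g (int p)"
begin

lemma pos: "0 < p" "0 < q"
  using order odd_h by (cases "p = 0"; cases "q = 0"; auto)+

lemma order': "int (p * q) = 2 * h" "int (q * p) = 2 * h"
  using order by (simp_all add: mult.commute)

lemma order_ge_2: "2 \<le> p * q"
proof -
  have "even (int (p * q))" unfolding order' by simp
  then have "even (p * q)" by (simp only: even_of_nat_iff)
  then show ?thesis using pos by (intro dvd_imp_le) auto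
qed

text \<open>A common divisor of \<open>h + 2\<close> and \<open>2 h\<close> is odd, so it divides \<open>h\<close>, hence also \<open>2\<close>.\<close>

lemma coprime_step: "coprime (h + 2) (int (p * q))"
proof -
  have "coprime 2 h" using odd_h by simp
  then have "coprime (h + 2) h" by (simp add: gcd_add1 coprime_iff_gcd_eq_1 gcd.commute)
  moreover have "coprime (h + 2) 2" using odd_h by simp
  ultimately show ?thesis unfolding order' by (simp add: coprime_mult_right_iff)
qed

text \<open>
  As \<open>q\<close> divides \<open>h + w\<close> and \<open>2 h\<close>, it divides \<open>2 w\<close>. Modulo \<open>q\<close> only the number of the coset remains.
\<close>

lemma coset_line_cong: "[coset_line p h w t = int (t div p)] (mod int q)"
proof -
  have w: "2 * w = int q * (2 * g - int p)" using coset_step order by (simp add: algebra_simps)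
  have "coset_line p h w t - int (t div p) =
      int q * (int (t mod p) * g - int (t div p) * (2 * g - int p))"
    unfolding coset_line_def coset_step w by (simp add: algebra_simps)
  then show ?thesis by (simp add: cong_iff_dvd_diff)
qed

text \<open>Inside a coset the walk consists of \<open>p\<close> consecutive multiples of a generator.\<close>

lemma coset_line_inj_on_band:
  assumes "s div p = t div p" "[coset_line p h w s = coset_line p h w t] (mod int (p * q))"
  shows "s = t"
proof -
  have "int q * int p dvd int q * ((int (s mod p) - int (t mod p)) * g)"
    using assms unfolding coset_line_def coset_step
    by (simp add: cong_iff_dvd_diff algebra_simps)
  then have "int p dvd (int (s mod p) - int (t mod p)) * g" using pos by simp
  then have "int p dvd int (s mod p) - int (t mod p)"
    using generator by (simp add: coprime_dvd_mult_left_iff coprime_commute)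
  then have "[int (s mod p) = int (t mod p)] (mod int p)" by (simp add: cong_iff_dvd_diff)
  then have "[int s = int t] (mod int p)" by (simp add: cong_def zmod_int)
  with assms(1) show ?thesis by (rule nat_eq_if_div_eq_cong)
qed

lemma inj_mod_coset_line: "inj_mod (p * q) (coset_line p h w)"
  unfolding inj_mod_def
proof (intro allI impI)
  fix s t assume s: "s < p * q" and t: "t < p * q"
    and eq: "[coset_line p h w s = coset_line p h w t] (mod int (p * q))"
  have "[coset_line p h w s = coset_line p h w t] (mod int q)"
    using eq by (rule cong_dvd_modulus) simp
  then have "[int (s div p) = int (t div p)] (mod int q)"
    by (rule cong_trans[OF cong_trans[OF cong_sym[OF coset_line_cong]] coset_line_cong])
  moreover have "s div p < q" "t div p < q"
    using s t by (simp_all add: less_mult_imp_div_less mult.commute)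
  ultimately have "s div p = t div p"
    unfolding cong_int_iff by (rule cong_less_modulus_unique_nat)
  then show "s = t" using eq by (rule coset_line_inj_on_band)
qed

lemma step_line_cong_imp:
  assumes "[step_line h s = step_line h t] (mod int m)" "m dvd p * q"
  shows "[int s = int t] (mod int m)"
proof -
  have "coprime (h + 2) (int m)"
    using coprime_step assms(2) by (meson coprime_divisors dvd_refl of_nat_dvd_iff)
  then show ?thesis using assms(1) unfolding step_line_def by (simp add: cong_mult_rcancel)
qed

lemma inj_mod_step_line: "inj_mod (p * q) (step_line h)"
  unfolding inj_mod_def
proof (intro allI impI)
  fix s t assume "s < p * q" "t < p * q"
    and "[step_line h s = step_line h t] (mod int (p * q))"
  then have "[s = t] (mod p * q)"
    using step_line_cong_imp[OF _ dvd_refl] by (simp only: cong_int_iff)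
  then show "s = t" using \<open>s < p * q\<close> \<open>t < p * q\<close> by (rule cong_less_modulus_unique_nat)
qed

text \<open>
  Modulo \<open>q\<close> the summand from the coset walk is constant on a block, and \<open>q\<close> consecutive multiples of
  \<open>h + 2\<close> are distinct; this recovers \<open>t\<close>, and then \<open>s\<close> is recovered modulo \<open>p q\<close>.
\<close>

lemma block_separation:
  assumes "s div p = s' div p" "t div q = t' div q"
    and eq: "[coset_line p h w s + step_line h t = coset_line p h w s' + step_line h t']
      (mod int (p * q))"
  shows "s = s' \<and> t = t'"
proof
  have "[coset_line p h w s + step_line h t = coset_line p h w s' + step_line h t'] (mod int q)"
    using eq by (rule cong_dvd_modulus) simp
  moreover have "[coset_line p h w s = coset_line p h w s'] (mod int q)"
    using cong_trans[OF coset_line_cong[of s, unfolded assms(1)] cong_sym[OF coset_line_cong[of s']]] .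
  ultimately have "[(coset_line p h w s + step_line h t) - coset_line p h w s =
      (coset_line p h w s' + step_line h t') - coset_line p h w s'] (mod int q)"
    by (rule cong_diff)
  then have "[step_line h t = step_line h t'] (mod int q)" by (simp only: add_diff_cancel_left')
  then have "[int t = int t'] (mod int q)" by (rule step_line_cong_imp) simp
  with assms(2) show t: "t = t'" by (rule nat_eq_if_div_eq_cong)
  have "[coset_line p h w s = coset_line p h w s'] (mod int (p * q))"
    using eq unfolding t cong_add_rcancel .
  with assms(1) show "s = s'" by (rule coset_line_inj_on_band)
qed

lemma near_antipodal_coset_line:
  assumes "0 < w"
  shows "near_antipodal h w (coset_line p h w (Suc t)) (coset_line p h w t)"
proof (cases "Suc (t mod p) = p")
  case False
  then have "coset_line p h w (Suc t) - coset_line p h w t = h + w"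
    by (simp add: coset_line_def mod_Suc div_Suc algebra_simps)
  then show ?thesis unfolding near_antipodal_def using assms by (intro exI[of _ w]) simp
next
  case True
  then have last: "int (t mod p) = int p - 1" by linarith
  have "coset_line p h w (Suc t) - coset_line p h w t = 1 - 2 * w - (int p - 1) * (h + w)"
    using True unfolding coset_line_def last by (simp add: mod_Suc div_Suc algebra_simps)
  also have "\<dots> = h + (1 - w) - int p * (h + w)" by (simp add: algebra_simps)
  also have "\<dots> = h + (1 - w) - 2 * h * g"
    unfolding coset_step order[symmetric] by (simp add: algebra_simps)
  finally have "[coset_line p h w (Suc t) - coset_line p h w t = h + (1 - w)] (mod 2 * h)"
    by (simp add: cong_iff_dvd_diff)
  moreover have "\<bar>1 - w\<bar> \<le> w" using assms by simp
  ultimately show ?thesis unfolding near_antipodal_def by blast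
qed

text \<open>
  For \<open>h = 1\<close> the step \<open>h + 2\<close> equals \<open>h\<close> modulo \<open>2 h\<close>, so that no slack is needed. This covers
  the squares of order 2, where \<open>w = 1\<close>.
\<close>

lemma near_antipodal_step_line:
  assumes "2 \<le> w \<or> h = 1 \<and> 0 \<le> w"
  shows "near_antipodal h w (step_line h (Suc t)) (step_line h t)"
proof -
  have step: "step_line h (Suc t) - step_line h t = h + 2" by (simp add: step_line_def algebra_simps)
  show ?thesis
  proof (cases "2 \<le> w")
    case True
    then show ?thesis unfolding near_antipodal_def step by (intro exI[of _ 2]) simp
  next
    case False
    then have "h = 1" "0 \<le> w" using assms by auto
    then show ?thesis unfolding near_antipodal_def step
      by (intro exI[of _ 0]) (simp add: cong_def)
  qed
qed

text \<open>
  The side of length \<open>p\<close> of a block must carry a coset. So the coset walk is the column sequence \<open>c\<close>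
  for blocks of shape \<open>q \<times> p\<close>, and the row sequence \<open>r\<close> for blocks of shape \<open>p \<times> q\<close>.
\<close>

lemma MiD_ge_columns_coset:
  assumes "0 < w" "2 \<le> w \<or> h = 1"
  shows "h - w \<le> MiD q p"
proof -
  let ?L = "cyclic_square (q * p) (step_line h) (coset_line p h w)"
  have two: "2 \<le> q * p" using order_ge_2 by (simp only: mult.commute[of q p])
  have "sudoku_latin_square q p ?L"
  proof (rule sudoku_cyclic_square[OF pos(2,1)])
    show "inj_mod (q * p) (step_line h)" "inj_mod (q * p) (coset_line p h w)"
      using inj_mod_step_line inj_mod_coset_line by (simp_all only: mult.commute[of q p])
    fix i i' j j' assume same: "i div q = i' div q" "j div p = j' div p"
      and eq: "[step_line h i + coset_line p h w j = step_line h i' + coset_line p h w j']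
        (mod int (q * p))"
    have "[coset_line p h w j + step_line h i = coset_line p h w j' + step_line h i']
        (mod int (p * q))"
      using eq by (simp only: add.commute[of "step_line h _"] mult.commute[of q p])
    from block_separation[OF same(2,1) this] show "i = i' \<and> j = j'" by simp
  qed
  then have "inner_distance (q * p) ?L \<le> MiD q p" by (rule inner_distance_le_MiD[OF two])
  moreover have "h - w \<le> inner_distance (q * p) ?L"
    using assms by (intro inner_distance_cyclic_square order' two
      near_antipodal_step_line near_antipodal_coset_line) auto
  ultimately show ?thesis by linarith
qed

lemma MiD_ge_rows_coset:
  assumes "0 < w" "2 \<le> w \<or> h = 1"
  shows "h - w \<le> MiD p q"
proof -
  let ?L = "cyclic_square (p * q) (coset_line p h w) (step_line h)"
  have "sudoku_latin_square p q ?L"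
    by (rule sudoku_cyclic_square[OF pos inj_mod_coset_line inj_mod_step_line block_separation])
  then have "inner_distance (p * q) ?L \<le> MiD p q" by (rule inner_distance_le_MiD[OF order_ge_2])
  moreover have "h - w \<le> inner_distance (p * q) ?L"
    using assms by (intro inner_distance_cyclic_square order' order_ge_2
      near_antipodal_step_line near_antipodal_coset_line) auto
  ultimately show ?thesis by linarith
qed

end

section \<open>The bound\<close>

theorem theorem4p9:
  fixes a b n :: nat
  assumes "0 < a" and "0 < b" and "a \<le> b"
    and "odd a" and "b mod 4 = 2"
    and "n = a * b"
  shows "real_of_int (MiD a b) \<ge> (real n - real (min (4 * a) b)) / 2"
proof -
  define m where "m = b div 2"
  have b: "b = 2 * m" and m: "odd m" using assms(5) unfolding m_def by presburger+
  obtain e where a: "a = 2 * e + 1" using assms(4) by (elim oddE)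
  obtain f where f: "m = 2 * f + 1" using m by (elim oddE)
  define h where "h = int (a * m)"
  have odd_h: "odd h" using assms(4) m by (simp add: h_def)
  have n: "real n = 2 * real_of_int h" using assms(6) b by (simp add: h_def)
  show ?thesis
  proof (cases "4 * a < b")
    case True
    \<comment> \<open>The multiples of \<open>a\<close> near \<open>h\<close> are \<open>h + a k = a (m + k)\<close>. Neither \<open>k = 0\<close> nor \<open>k = 1\<close> always
      gives a generator, as \<open>b = 2 m\<close> and \<open>m + 1\<close> is even; \<open>k = 2\<close> does.\<close>
    have "coprime 2 (int m)" using m by simp
    then have "coprime (int m + 2) (int m)"
      by (simp add: gcd_add1 coprime_iff_gcd_eq_1 gcd.commute)
    moreover have "coprime (int m + 2) 2" using m by simp
    ultimately have "coprime (int m + 2) (int b)" by (simp add: b coprime_mult_right_iff)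
    then interpret line_pair b a h "2 * int a" "int m + 2"
      using odd_h by unfold_locales (simp_all add: b h_def algebra_simps)
    have "h - 2 * int a \<le> MiD a b" using assms(1) by (intro MiD_ge_columns_coset) auto
    then have "real_of_int (h - 2 * int a) \<le> real_of_int (MiD a b)" by (simp only: of_int_le_iff)
    then show ?thesis using True n by simp
  next
    case False
    \<comment> \<open>\<open>h + m = m (a + 1) = b (e + 1)\<close>, and \<open>2 (e + 1) - a = 1\<close>.\<close>
    have "coprime (int e + 1) (int a)"
    proof (rule coprimeI)
      fix c assume "c dvd int e + 1" "c dvd int a"
      then have "c dvd 2 * (int e + 1) - int a" by (intro dvd_diff dvd_mult) auto
      then show "is_unit c" by (simp add: a)
    qed
    then interpret line_pair a b h "int m" "int e + 1"
      using odd_h by unfold_locales (simp_all add: a b h_def algebra_simps)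
    have "2 \<le> int m \<or> h = 1"
    proof (cases "m = 1")
      case True
      then have "a = 1" using assms(3) b assms(4) by presburger
      then show ?thesis using True by (simp add: h_def)
    qed (use f in auto)
    then have "h - int m \<le> MiD a b" using f by (intro MiD_ge_rows_coset) auto
    then have "real_of_int (h - int m) \<le> real_of_int (MiD a b)" by (simp only: of_int_le_iff)
    then show ?thesis using False n b by simp
  qed
qed

end
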